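(* Let $\mathcal{H}_A$ and $\mathcal{H}_B$ be finite-dimensional complex Hilbert spaces with $d_A=\dim\mathcal{H}_A>1$. Let $\rho_A$ be a state on $\mathcal{H}_A$ with $\rho_A\neq I_A/d_A$, and let $\mathcal{E}:\mathcal{L}(\mathcal{H}_A)\to\mathcal{L}(\mathcal{H}_B)$ be a quantum channel that is not a discard-and-prepare channel. For a rank-one orthogonal projector $P=|v\rangle\langle v|$ on $\mathcal{H}_A$ (with $|v\rangle$ a unit vector), put $\Delta_P(\rho_A)=[P,[P,\rho_A]]$ and $Y_P=\mathcal{E}(\Delta_P(\rho_A))$. Then: (1) there exists a unit vector $|v\rangle\in\mathcal{H}_A$ such that $Y_P\neq 0$ for $P=|v\rangle\langle v|$; (2) for any such $P$, the operator $Y_P$ is Hermitian and traceless and has a non-zero real eigenvalue; and for any non-zero eigenvalue $y_0$ of $Y_P$ with corresponding normalized eigenvector $|y\rangle\in\mathcal{H}_B$, setting $Q=|y\rangle\langle y|$, one has $$\operatorname{Tr}\big(\mathcal{E}(\rho_A)Q\big)-\operatorname{Tr}\big(\mathcal{E}(P\rho_A P+(I_A-P)\rho_A(I_A-P))Q\big)=\operatorname{Tr}(Y_PQ)=y_0\neq 0 .$$ In particular, there exist binary projective measurements $\{P,I_A-P\}$ on $\mathcal{H}_A$ and $\{Q,I_B-Q\}$ on $\mathcal{H}_B$ that violate the no-signalling in time (NSIT) condition.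
   Context: $\mathcal{L}(\mathcal{H})$ denotes the algebra of linear operators on $\mathcal{H}$; $I_A, I_B$ are the identity operators on $\mathcal{H}_A,\mathcal{H}_B$; $[X,Y]=XY-YX$. A state on $\mathcal{H}$ is a positive semidefinite operator of trace one. A quantum channel is a completely positive trace-preserving linear map. A channel $\mathcal{E}$ is a discard-and-prepare channel if there exists a state $\sigma_B$ on $\mathcal{H}_B$ such that $\mathcal{E}(\omega_A)=\sigma_B$ for all states $\omega_A$ on $\mathcal{H}_A$. A projective measurement on $\mathcal{H}$ is a finite family $\{P_i\}$ of orthogonal (Hermitian) projections with $P_iP_j=\delta_{ij}P_i$ and $\sum_iP_i$ equal to the identity. Projective measurements $\{P_i\}$ on $\mathcal{H}_A$ and $\{Q_j\}$ on $\mathcal{H}_B$ satisfy the NSIT condition (relative to $\rho_A$ and $\mathcal{E}$) if $\sum_i \operatorname{Tr}(\mathcal{E}(P_i\rho_A P_i)Q_j)=\operatorname{Tr}(\mathcal{E}(\rho_A)Q_j)$ for all $j$; otherwise they violate it. *)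

theory Defs
  imports "Jordan_Normal_Form.Schur_Decomposition"
begin

text \<open>
  A Hilbert space of finite dimension \<open>d\<close> is represented by its coordinates in an orthonormal
  basis: vectors are \<^term>\<open>carrier_vec d\<close> and operators are \<^term>\<open>carrier_mat d d\<close>, over the
  complex numbers. The library product \<open>v \<bullet>c w\<close> is conjugate-linear in its second argument.
\<close>

definition unit_vector :: "nat \<Rightarrow> complex vec \<Rightarrow> bool" where
  "unit_vector d v \<longleftrightarrow> v \<in> carrier_vec d \<and> v \<bullet>c v = 1"

definition ketbra :: "complex vec \<Rightarrow> complex mat" where
  "ketbra v = mat (dim_vec v) (dim_vec v) (\<lambda>(i, j). v $ i * cnj (v $ j))"

definition mat_trace :: "complex mat \<Rightarrow> complex" where
  "mat_trace A = (\<Sum>i<dim_row A. A $$ (i, i))"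

definition hermitian :: "complex mat \<Rightarrow> bool" where
  "hermitian A \<longleftrightarrow> mat_adjoint A = A"

definition commutator :: "complex mat \<Rightarrow> complex mat \<Rightarrow> complex mat" where
  "commutator X Y = X * Y - Y * X"

text \<open>
  In the order on the complex numbers, \<open>0 \<le> z\<close> means that \<open>z\<close> is real and nonnegative; so the
  condition below entails hermiticity.
\<close>

definition psd :: "nat \<Rightarrow> complex mat \<Rightarrow> bool" where
  "psd d A \<longleftrightarrow> A \<in> carrier_mat d d \<and> (\<forall>v \<in> carrier_vec d. 0 \<le> (A *\<^sub>v v) \<bullet>c v)"

definition state :: "nat \<Rightarrow> complex mat \<Rightarrow> bool" where
  "state d \<rho> \<longleftrightarrow> psd d \<rho> \<and> mat_trace \<rho> = 1"

definition linear_map :: "nat \<Rightarrow> nat \<Rightarrow> (complex mat \<Rightarrow> complex mat) \<Rightarrow> bool" where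
  "linear_map dA dB \<E> \<longleftrightarrow>
     (\<forall>X \<in> carrier_mat dA dA. \<E> X \<in> carrier_mat dB dB) \<and>
     (\<forall>X \<in> carrier_mat dA dA. \<forall>Y \<in> carrier_mat dA dA. \<E> (X + Y) = \<E> X + \<E> Y) \<and>
     (\<forall>c. \<forall>X \<in> carrier_mat dA dA. \<E> (c \<cdot>\<^sub>m X) = c \<cdot>\<^sub>m \<E> X)"

text \<open>
  Identifying operators on the tensor product of a \<open>k\<close>-dimensional and a \<open>d\<close>-dimensional space
  with \<open>k \<times> k\<close> block matrices having blocks of size \<open>d \<times> d\<close>, the map \<open>id\<^sub>k \<otimes> \<E>\<close> applies \<open>\<E>\<close> to
  every block.
\<close>

definition block :: "nat \<Rightarrow> complex mat \<Rightarrow> nat \<Rightarrow> nat \<Rightarrow> complex mat" where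
  "block d X a b = mat d d (\<lambda>(i, j). X $$ (a * d + i, b * d + j))"

definition ampliation ::
  "nat \<Rightarrow> nat \<Rightarrow> nat \<Rightarrow> (complex mat \<Rightarrow> complex mat) \<Rightarrow> complex mat \<Rightarrow> complex mat" where
  "ampliation k dA dB \<E> X = mat (k * dB) (k * dB)
     (\<lambda>(i, j). \<E> (block dA X (i div dB) (j div dB)) $$ (i mod dB, j mod dB))"

definition completely_positive ::
  "nat \<Rightarrow> nat \<Rightarrow> (complex mat \<Rightarrow> complex mat) \<Rightarrow> bool" where
  "completely_positive dA dB \<E> \<longleftrightarrow>
     (\<forall>k X. psd (k * dA) X \<longrightarrow> psd (k * dB) (ampliation k dA dB \<E> X))"

definition quantum_channel :: "nat \<Rightarrow> nat \<Rightarrow> (complex mat \<Rightarrow> complex mat) \<Rightarrow> bool" where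
  "quantum_channel dA dB \<E> \<longleftrightarrow>
     linear_map dA dB \<E> \<and> completely_positive dA dB \<E> \<and>
     (\<forall>X \<in> carrier_mat dA dA. mat_trace (\<E> X) = mat_trace X)"

definition discard_and_prepare :: "nat \<Rightarrow> nat \<Rightarrow> (complex mat \<Rightarrow> complex mat) \<Rightarrow> bool" where
  "discard_and_prepare dA dB \<E> \<longleftrightarrow> (\<exists>\<sigma>. state dB \<sigma> \<and> (\<forall>\<omega>. state dA \<omega> \<longrightarrow> \<E> \<omega> = \<sigma>))"

definition projective_measurement :: "nat \<Rightarrow> complex mat list \<Rightarrow> bool" where
  "projective_measurement d Ps \<longleftrightarrow>
     (\<forall>i < length Ps. Ps ! i \<in> carrier_mat d d \<and> hermitian (Ps ! i)) \<and>
     (\<forall>i < length Ps. \<forall>j < length Ps. Ps ! i * Ps ! j = (if i = j then Ps ! i else 0\<^sub>m d d)) \<and>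
     foldr (+) Ps (0\<^sub>m d d) = 1\<^sub>m d"

definition NSIT ::
  "complex mat \<Rightarrow> (complex mat \<Rightarrow> complex mat) \<Rightarrow> complex mat list \<Rightarrow> complex mat list \<Rightarrow> bool" where
  "NSIT \<rho> \<E> Ps Qs \<longleftrightarrow>
     (\<forall>Q \<in> set Qs. (\<Sum>P\<leftarrow>Ps. mat_trace (\<E> (P * \<rho> * P) * Q)) = mat_trace (\<E> \<rho> * Q))"

definition Delta :: "complex mat \<Rightarrow> complex mat \<Rightarrow> complex mat" where
  "Delta P \<rho> = commutator P (commutator P \<rho>)"

end

(*
  For a rank-one projection P, Delta_P(rho) = rho - P rho P - (1-P) rho (1-P); this writes Y_P as a
  combination of images of positive operators, hence Hermitian, and gives the identity in (2).

  For (1), suppose every Y_P vanishes and apply a matrix entry of the channel, written X |-> Tr(T X).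
  This yields <v|v> <v|(rho T + T rho)|v> = 2 <v|rho|v> <v|T|v> for all v. Evaluated on v = u + s w
  with u, w eigenvectors of rho for different eigenvalues, it forces T to be a multiple of the
  identity on the span of u and w; as rho is not scalar, T is then scalar altogether. So the channel
  depends on the trace of its argument only, i.e. it discards and prepares.
*)
theory Submission
  imports Defs
begin

subsection \<open>The sesquilinear form of an operator\<close>

text \<open>A matrix entry of the channel need not be a Hermitian functional, so
  \<open><u|T|w>\<close> and \<open><w|T|u>\<close> are independent unknowns. Real values of
  \<open>s\<close> would only control their sum; imaginary values give the difference.

  For unit vectors the identity is quadratic in \<open>v\<close> on one side and quartic on the
  other. The factor \<open><v|v>\<close> restores homogeneity, so that it can be tested on
  \<open>u + s w\<close> without normalising.

  Comparing eigenvectors for different eigenvalues says nothing about off-diagonal values inside one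
  eigenspace. However, each of its non-zero vectors can be compared with an eigenvector for another
  eigenvalue, which gives all of them the same normalised expectation of \<open>T\<close>;
  polarisation then removes the off-diagonal values.

  No orthonormal eigenbasis is constructed. Its role is played by completeness: a vector orthogonal
  to all eigenvectors of a Hermitian matrix is zero. This yields two different eigenvalues of rho,
  the vanishing of \<open>T - k\<close>, and the non-zero eigenvalue of Y_P.\<close>

text \<open>In Dirac notation this is \<open><y|T|x>\<close>: the arguments appear in the opposite
  order, linear in \<open>x\<close> and conjugate-linear in \<open>y\<close>.\<close>

definition sform :: "complex mat \<Rightarrow> complex vec \<Rightarrow> complex vec \<Rightarrow> complex" where
  "sform T x y = (T *\<^sub>v x) \<bullet>c y"

lemma sform_add_left:
  assumes "T \<in> carrier_mat d d" "x \<in> carrier_vec d" "y \<in> carrier_vec d" "z \<in> carrier_vec d"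
  shows "sform T (x + y) z = sform T x z + sform T y z"
  unfolding sform_def mult_add_distrib_mat_vec[OF assms(1-3)]
  using assms by (intro add_scalar_prod_distrib[of _ d]) auto

lemma sform_add_right:
  assumes "T \<in> carrier_mat d d" "x \<in> carrier_vec d" "y \<in> carrier_vec d" "z \<in> carrier_vec d"
  shows "sform T x (y + z) = sform T x y + sform T x z"
  unfolding sform_def conjugate_add_vec[OF assms(3,4)]
  using assms by (intro scalar_prod_add_distrib[of _ d]) auto

lemma sform_smult_left:
  assumes "T \<in> carrier_mat d d" "x \<in> carrier_vec d" "y \<in> carrier_vec d"
  shows "sform T (c \<cdot>\<^sub>v x) y = c * sform T x y"
  using assms by (simp add: sform_def mult_mat_vec[OF assms(1,2)])

lemma sform_smult_right:
  assumes "T \<in> carrier_mat d d" "x \<in> carrier_vec d" "y \<in> carrier_vec d"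
  shows "sform T x (c \<cdot>\<^sub>v y) = cnj c * sform T x y"
  using assms by (simp add: sform_def conjugate_smult_vec)

lemmas sform_linear = sform_add_left sform_add_right sform_smult_left sform_smult_right

lemma sform_one:
  assumes "x \<in> carrier_vec d"
  shows "sform (1\<^sub>m d) x y = x \<bullet>c y"
  using assms by (simp add: sform_def)

lemma sform_sum:
  assumes "T \<in> carrier_mat d d" "x \<in> carrier_vec d" "y \<in> carrier_vec d"
  shows "sform T x y = (\<Sum>i<d. \<Sum>j<d. T $$ (i, j) * x $ j * cnj (y $ i))"
  using assms by (auto simp: sform_def scalar_prod_def sum_distrib_right lessThan_atLeast0
      intro!: sum.cong)

lemma cscalar_prod_sum:
  assumes "x \<in> carrier_vec d" "y \<in> carrier_vec d"
  shows "x \<bullet>c y = (\<Sum>i<d. x $ i * cnj (y $ i))"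
  using assms by (auto simp: scalar_prod_def lessThan_atLeast0 intro!: sum.cong)

lemma cnj_cscalar_prod:
  assumes "x \<in> carrier_vec d" "y \<in> carrier_vec d"
  shows "cnj (x \<bullet>c y) = y \<bullet>c x"
  by (simp add: cscalar_prod_sum[OF assms] cscalar_prod_sum[OF assms(2,1)] mult.commute)

lemma mat_eq_if_sform_eq:
  assumes "A \<in> carrier_mat d d" "B \<in> carrier_mat d d"
    and "\<And>x y. x \<in> carrier_vec d \<Longrightarrow> y \<in> carrier_vec d \<Longrightarrow> sform A x y = sform B x y"
  shows "A = B"
proof (rule eq_matI)
  fix i j assume "i < dim_row B" "j < dim_col B"
  hence ij: "i < d" "j < d" using assms by auto
  have ent: "sform M (unit_vec d j) (unit_vec d i) = M $$ (i, j)" if "M \<in> carrier_mat d d" for M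
  proof -
    have "sform M (unit_vec d j) (unit_vec d i)
        = (\<Sum>k<d. \<Sum>l<d. if k = i then if l = j then M $$ (k, l) else 0 else 0)"
      using ij by (auto simp: sform_sum[OF that] unit_vec_def intro!: sum.cong)
    also have "\<dots> = (\<Sum>k<d. if k = i then \<Sum>l<d. if l = j then M $$ (k, l) else 0 else 0)"
      by (intro sum.cong) auto
    finally show ?thesis using ij by simp
  qed
  show "A $$ (i, j) = B $$ (i, j)"
    using ent[OF assms(1)] ent[OF assms(2)] assms(3)[of "unit_vec d j" "unit_vec d i"] by simp
qed (use assms in auto)

section \<open>Hermiticity in terms of entries, of the sesquilinear form, and of the quadratic
  form\<close>

lemma mat_adjoint_index:
  fixes A :: "complex mat"
  assumes "i < dim_col A" "j < dim_row A"
  shows "mat_adjoint A $$ (i, j) = cnj (A $$ (j, i))"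
  using assms by (simp add: mat_adjoint_def mat_of_rows_index)

lemma mat_adjoint_carrier:
  fixes A :: "complex mat"
  assumes "A \<in> carrier_mat m n"
  shows "mat_adjoint A \<in> carrier_mat n m"
  using assms by (auto simp: mat_adjoint_def)

lemma hermitian_iff_index:
  assumes "A \<in> carrier_mat d d"
  shows "hermitian A \<longleftrightarrow> (\<forall>i<d. \<forall>j<d. cnj (A $$ (j, i)) = A $$ (i, j))"
proof -
  have "hermitian A \<longleftrightarrow> (\<forall>i<d. \<forall>j<d. mat_adjoint A $$ (i, j) = A $$ (i, j))"
    using assms mat_adjoint_carrier[OF assms] by (auto simp: hermitian_def intro!: eq_matI)
  moreover have "mat_adjoint A $$ (i, j) = cnj (A $$ (j, i))" if "i < d" "j < d" for i j
    using that assms by (intro mat_adjoint_index) auto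
  ultimately show ?thesis by metis
qed

lemma hermitian_iff_sform:
  assumes "A \<in> carrier_mat d d"
  shows "hermitian A \<longleftrightarrow>
    (\<forall>x\<in>carrier_vec d. \<forall>y\<in>carrier_vec d. sform A x y = x \<bullet>c (A *\<^sub>v y))"
proof -
  have adj: "x \<bullet>c (A *\<^sub>v y) = sform (mat_adjoint A) x y"
    if "x \<in> carrier_vec d" "y \<in> carrier_vec d" for x y
  proof -
    have "x \<bullet>c (A *\<^sub>v y) = cnj (sform A y x)"
      unfolding sform_def using that assms by (intro cnj_cscalar_prod[symmetric]) auto
    also have "\<dots> = (\<Sum>i<d. \<Sum>j<d. cnj (A $$ (i, j) * y $ j * cnj (x $ i)))"
      using that assms by (simp add: sform_sum)
    also have "\<dots> = (\<Sum>j<d. \<Sum>i<d. cnj (A $$ (i, j) * y $ j * cnj (x $ i)))"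
      by (rule sum.swap)
    also have "\<dots> = sform (mat_adjoint A) x y"
      using that assms mat_adjoint_carrier[OF assms]
      by (auto simp: sform_sum mat_adjoint_index intro!: sum.cong)
    finally show ?thesis .
  qed
  show ?thesis
    using adj mat_eq_if_sform_eq[OF mat_adjoint_carrier[OF assms] assms]
    by (auto simp: hermitian_def)
qed

lemma hermitian_sform:
  assumes "A \<in> carrier_mat d d" "hermitian A" "x \<in> carrier_vec d" "y \<in> carrier_vec d"
  shows "(A *\<^sub>v x) \<bullet>c y = x \<bullet>c (A *\<^sub>v y)"
  using assms hermitian_iff_sform by (auto simp: sform_def)

text \<open>Polarisation: reality at \<open>x + y\<close> equates the imaginary parts of
  \<open>sform A x y\<close> and \<open>cnj (sform A y x)\<close>, reality at
  \<open>x + \<i> y\<close> their real parts.\<close>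

lemma hermitian_if_sform_real:
  assumes A: "A \<in> carrier_mat d d"
    and re: "\<And>v. v \<in> carrier_vec d \<Longrightarrow> sform A v v \<in> \<real>"
  shows "hermitian A"
proof -
  have "sform A x y = cnj (sform A y x)"
    if xy: "x \<in> carrier_vec d" "y \<in> carrier_vec d" for x y
  proof -
    have 1: "sform A (x + y) (x + y) = sform A x x + sform A y y + (sform A x y + sform A y x)"
      using xy A by (simp add: sform_linear[of A d])
    have 2: "sform A (x + \<i> \<cdot>\<^sub>v y) (x + \<i> \<cdot>\<^sub>v y)
        = sform A x x + sform A y y + (- \<i> * sform A x y + \<i> * sform A y x)"
      using xy A by (simp add: sform_linear[of A d] algebra_simps)
    have "Im (sform A x x) = 0" "Im (sform A y y) = 0"
      "Im (sform A (x + y) (x + y)) = 0" "Im (sform A (x + \<i> \<cdot>\<^sub>v y) (x + \<i> \<cdot>\<^sub>v y)) = 0"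
      using re xy by (auto simp: complex_is_Real_iff)
    thus ?thesis unfolding 1 2 by (simp add: complex_eq_iff)
  qed
  moreover have "cnj (sform A y x) = x \<bullet>c (A *\<^sub>v y)"
    if xy: "x \<in> carrier_vec d" "y \<in> carrier_vec d" for x y
    unfolding sform_def using that A by (intro cnj_cscalar_prod) auto
  ultimately show ?thesis using hermitian_iff_sform[OF A] by simp
qed

lemma psd_hermitian:
  assumes "psd d A"
  shows "hermitian A"
  using assms by (intro hermitian_if_sform_real[of A d])
    (auto simp: psd_def sform_def nonnegative_complex_is_real)

subsection \<open>Eigenvectors of Hermitian matrices\<close>

lemma hermitian_eigenvalue_real:
  assumes A: "A \<in> carrier_mat d d" "hermitian A" and v: "v \<in> carrier_vec d" "v \<noteq> 0\<^sub>v d"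
    and ev: "A *\<^sub>v v = a \<cdot>\<^sub>v v"
  shows "cnj a = a"
proof -
  have "a * (v \<bullet>c v) = cnj a * (v \<bullet>c v)"
    using hermitian_sform[OF A v(1) v(1)] v(1) unfolding ev by (simp add: conjugate_smult_vec)
  thus ?thesis using v conjugate_square_eq_0_vec[of v d] by simp
qed

lemma hermitian_eigenvectors_orthogonal:
  assumes A: "A \<in> carrier_mat d d" "hermitian A" and v: "v \<in> carrier_vec d" and w: "w \<in> carrier_vec d"
    and ev: "A *\<^sub>v v = a \<cdot>\<^sub>v v" "A *\<^sub>v w = b \<cdot>\<^sub>v w" and ab: "a \<noteq> b"
  shows "v \<bullet>c w = 0"
proof (cases "w = 0\<^sub>v d")
  case True
  thus ?thesis using v by simp
next
  case False
  have "a * (v \<bullet>c w) = cnj b * (v \<bullet>c w)"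
    using hermitian_sform[OF A v w] v w unfolding ev by (simp add: conjugate_smult_vec)
  thus ?thesis using ab hermitian_eigenvalue_real[OF A w False ev(2)] by simp
qed

text \<open>
  The orthogonal complement of the eigenvectors is invariant, so if it were non-zero it would
  contain an eigenvector. In triangularising coordinates \<open>x = P *\<^sub>v y\<close>, applying \<open>A - e\<close> with \<open>e\<close>
  a diagonal entry of the triangular form shortens the support of \<open>y\<close>.
\<close>
lemma orthogonal_to_eigenvectors_zero:
  assumes A: "A \<in> carrier_mat d d" "hermitian A" and x: "x \<in> carrier_vec d"
    and orth: "\<And>v a. v \<in> carrier_vec d \<Longrightarrow> A *\<^sub>v v = a \<cdot>\<^sub>v v \<Longrightarrow> x \<bullet>c v = 0"
  shows "x = 0\<^sub>v d"
proof -
  obtain es where "char_poly A = (\<Prod>a\<leftarrow>es. [:- a, 1:])"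
    using char_poly_factorized[OF A(1)] by auto
  then obtain B where B: "B \<in> carrier_mat d d" "upper_triangular B" "similar_mat A B"
    using schur_decomposition_exists[OF A(1)] by blast
  obtain P Q where "similar_mat_wit A B P Q"
    using B(3) by (auto simp: similar_mat_def)
  note sim = similar_mat_witD2[OF A(1) this]
  hence P: "P \<in> carrier_mat d d" and Q: "Q \<in> carrier_mat d d" by auto
  have AP: "A * P = P * B"
  proof -
    have "A * P = (P * B * Q) * P" using sim by simp
    also have "\<dots> = P * B * (Q * P)" using P Q B by (intro assoc_mult_mat) auto
    finally show ?thesis using sim P B by simp
  qed
  \<comment> \<open>The orthogonal complement of all eigenvectors, with no restriction on the
    eigenvalue.\<close>
  define W where
    "W = {x \<in> carrier_vec d. \<forall>v a. v \<in> carrier_vec d \<longrightarrow> A *\<^sub>v v = a \<cdot>\<^sub>v v \<longrightarrow> x \<bullet>c v = 0}"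
  have main: "y = 0\<^sub>v d"
    if "k \<le> d" "y \<in> carrier_vec d" "\<And>i. k \<le> i \<Longrightarrow> i < d \<Longrightarrow> y $ i = 0" "P *\<^sub>v y \<in> W" for k y
    using that
  proof (induction k arbitrary: y)
    case 0
    thus ?case by auto
  next
    case (Suc k)
    \<comment> \<open>Position \<open>k\<close> is the last one at which \<open>y\<close> may be
      non-zero. Since \<open>B\<close> is upper triangular, subtracting its diagonal entry there
      makes \<open>z\<close> vanish from position \<open>k\<close> on.\<close>
    define e where "e = B $$ (k, k)"
    define z where "z = B *\<^sub>v y + (- e) \<cdot>\<^sub>v y"
    let ?x = "P *\<^sub>v y"
    have x: "?x \<in> carrier_vec d" using P Suc.prems by simp
    have z: "z \<in> carrier_vec d" using B Suc.prems by (simp add: z_def)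
    have "P *\<^sub>v z = P *\<^sub>v (B *\<^sub>v y) + (- e) \<cdot>\<^sub>v ?x"
      unfolding z_def using P B Suc.prems
      by (simp add: mult_add_distrib_mat_vec[of P d d] mult_mat_vec[of P d d])
    also have "P *\<^sub>v (B *\<^sub>v y) = A *\<^sub>v ?x"
      using P B A AP Suc.prems by (metis assoc_mult_mat_vec)
    finally have Pz: "P *\<^sub>v z = A *\<^sub>v ?x + (- e) \<cdot>\<^sub>v ?x" .
    \<comment> \<open>Invariance of the complement: for an eigenvector \<open>v\<close>, moving
      \<open>A\<close> onto \<open>v\<close> only produces a multiple of the vanishing product of
      \<open>?x\<close> and \<open>v\<close>.\<close>
    have "P *\<^sub>v z \<in> W"
    proof -
      have "(P *\<^sub>v z) \<bullet>c v = 0" if v: "v \<in> carrier_vec d" "A *\<^sub>v v = a \<cdot>\<^sub>v v" for v a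
      proof -
        have xv: "?x \<bullet>c v = 0" using Suc.prems(4) v by (auto simp: W_def)
        have "(A *\<^sub>v ?x) \<bullet>c v = 0"
          using hermitian_sform[OF A x v(1)] x v xv by (simp add: conjugate_smult_vec)
        moreover have "(P *\<^sub>v z) \<bullet>c v = (A *\<^sub>v ?x) \<bullet>c v + ((- e) \<cdot>\<^sub>v ?x) \<bullet>c v"
          unfolding Pz using x v A by (intro add_scalar_prod_distrib[of _ d]) auto
        moreover have "((- e) \<cdot>\<^sub>v ?x) \<bullet>c v = - e * (?x \<bullet>c v)"
          using x v by (intro smult_scalar_prod_distrib[of _ d]) auto
        ultimately show ?thesis using xv by simp
      qed
      thus ?thesis using P z by (auto simp: W_def)
    qed
    moreover have "z $ i = 0" if i: "k \<le> i" "i < d" for i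
    proof -
      have "z $ i = (\<Sum>j<d. B $$ (i, j) * y $ j) - e * y $ i"
        using i B Suc.prems(2) by (auto simp: z_def scalar_prod_def lessThan_atLeast0)
      also have "(\<Sum>j<d. B $$ (i, j) * y $ j) = (\<Sum>j<d. if j = k then B $$ (i, j) * y $ j else 0)"
      proof (rule sum.cong[OF refl])
        fix j assume "j \<in> {..<d}"
        hence j: "j < d" by simp
        show "B $$ (i, j) * y $ j = (if j = k then B $$ (i, j) * y $ j else 0)"
          using upper_triangularD[OF B(2), of j i] Suc.prems(3)[of j] i j B(1)
          by (cases j k rule: linorder_cases) auto
      qed
      also have "\<dots> = B $$ (i, k) * y $ k" using Suc.prems(1) by simp
      finally show ?thesis
        using upper_triangularD[OF B(2), of k i] Suc.prems(3)[of i] i B(1)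
        by (cases "i = k") (auto simp: e_def)
    qed
    ultimately have z0: "z = 0\<^sub>v d" using Suc.IH[of z] Suc.prems(1) z by simp
    have "A *\<^sub>v ?x = e \<cdot>\<^sub>v ?x"
    proof (rule eq_vecI)
      fix i assume "i < dim_vec (e \<cdot>\<^sub>v ?x)"
      hence i: "i < d" using P by simp
      have "(A *\<^sub>v ?x + (- e) \<cdot>\<^sub>v ?x) $ i = 0" unfolding Pz[symmetric] z0 using P i by simp
      thus "(A *\<^sub>v ?x) $ i = (e \<cdot>\<^sub>v ?x) $ i" using i x A P by simp
    qed (use A P in auto)
    \<comment> \<open>Now \<open>?x\<close> satisfies the eigenvector equation and lies in the
      complement, so it is orthogonal to itself.\<close>
    hence "?x \<bullet>c ?x = 0" using Suc.prems(4) by (auto simp: W_def)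
    hence x0: "?x = 0\<^sub>v d" using x by simp
    have "Q *\<^sub>v ?x = y"
      using sim Suc.prems(2) by (metis assoc_mult_mat_vec one_mult_mat_vec)
    moreover have "Q *\<^sub>v 0\<^sub>v d = 0\<^sub>v d" using Q by (auto simp: scalar_prod_def)
    ultimately show ?case unfolding x0 by simp
  qed
  have "P *\<^sub>v (Q *\<^sub>v x) = x" using sim x by (metis assoc_mult_mat_vec one_mult_mat_vec)
  moreover have "x \<in> W" using x orth by (auto simp: W_def)
  moreover have "Q *\<^sub>v x = 0\<^sub>v d" using calculation Q x by (intro main[of d]) auto
  ultimately show ?thesis using P by auto
qed

text \<open>Annihilating \<open>v\<close> means that every conjugated row of \<open>M\<close> is
  orthogonal to \<open>v\<close>; completeness of the eigenvectors then makes each row zero. This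
  replaces expansion in an eigenbasis.\<close>

lemma zero_on_eigenvectors_zero:
  assumes A: "A \<in> carrier_mat d d" "hermitian A" and M: "M \<in> carrier_mat d d"
    and ker: "\<And>v a. v \<in> carrier_vec d \<Longrightarrow> A *\<^sub>v v = a \<cdot>\<^sub>v v \<Longrightarrow> M *\<^sub>v v = 0\<^sub>v d"
  shows "M = 0\<^sub>m d d"
proof -
  have rows: "conjugate (row M i) = 0\<^sub>v d" if i: "i < d" for i
  proof (rule orthogonal_to_eigenvectors_zero[OF A])
    show c: "conjugate (row M i) \<in> carrier_vec d" using M by auto
    fix v a assume v: "v \<in> carrier_vec d" "A *\<^sub>v v = a \<cdot>\<^sub>v v"
    have "row M i \<bullet> v = (M *\<^sub>v v) $ i" using M i by simp
    hence "row M i \<bullet> v = 0" using ker[OF v] i by simp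
    moreover have "cnj (conjugate (row M i) \<bullet>c v) = v \<bullet> row M i"
      using cnj_cscalar_prod[OF c v(1)] by simp
    ultimately show "conjugate (row M i) \<bullet>c v = 0"
      using comm_scalar_prod[of v d "row M i"] M v by auto
  qed
  show ?thesis
  proof (rule eq_matI)
    fix i j assume "i < dim_row (0\<^sub>m d d)" "j < dim_col (0\<^sub>m d d)"
    hence "conjugate (row M i) $ j = 0" "i < d" "j < d" using rows by auto
    thus "M $$ (i, j) = 0\<^sub>m d d $$ (i, j)" using M by simp
  qed (use M in auto)
qed

subsection \<open>Products of expectation values\<close>

text \<open>On \<open>u + s w\<close> the difference of the two sides of \<open>H\<close> is
  \<open>a - b\<close> times an expression in \<open>s\<close> and \<open>cnj s\<close>. Varying
  \<open>s\<close> separates its diagonal part \<open>D\<close> from its off-diagonal part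
  \<open>K s\<close>.\<close>

lemma eigenvectors_of_product_form:
  assumes A: "A \<in> carrier_mat d d" "hermitian A" and T: "T \<in> carrier_mat d d"
    and H: "\<And>v. v \<in> carrier_vec d \<Longrightarrow>
      (v \<bullet>c v) * (sform T v (A *\<^sub>v v) + sform T (A *\<^sub>v v) v) = 2 * sform A v v * sform T v v"
    and u: "u \<in> carrier_vec d" "u \<noteq> 0\<^sub>v d" "A *\<^sub>v u = a \<cdot>\<^sub>v u"
    and w: "w \<in> carrier_vec d" "w \<noteq> 0\<^sub>v d" "A *\<^sub>v w = b \<cdot>\<^sub>v w"
    and ab: "a \<noteq> b"
  shows "sform T u w = 0" "(w \<bullet>c w) * sform T u u = (u \<bullet>c u) * sform T w w"
proof -
  define N M where "N = u \<bullet>c u" and "M = w \<bullet>c w"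
  have N0: "N \<noteq> 0" using u by (simp add: N_def)
  have re: "cnj a = a" "cnj b = b"
    using hermitian_eigenvalue_real[OF A] u w by blast+
  have orth: "u \<bullet>c w = 0" "w \<bullet>c u = 0"
    using hermitian_eigenvectors_orthogonal[OF A u(1) w(1) u(3) w(3) ab]
      hermitian_eigenvectors_orthogonal[OF A w(1) u(1) w(3) u(3) ab[symmetric]] by auto
  \<comment> \<open>\<open>D\<close> compares the expectations of \<open>T\<close> in
    \<open>u\<close> and \<open>w\<close> with the norms multiplied out; \<open>K s\<close> collects
    the cross terms of \<open>sform T v v\<close>.\<close>
  define D K where "D = M * sform T u u - N * sform T w w"
    and "K s = cnj s * sform T u w + s * sform T w u" for s
  have key: "2 * (s * cnj s) * D + (s * cnj s * M - N) * K s = 0" for s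
  proof -
    define v where "v = u + s \<cdot>\<^sub>v w"
    have v: "v \<in> carrier_vec d" using u w by (simp add: v_def)
    have Av: "A *\<^sub>v v = a \<cdot>\<^sub>v u + (s * b) \<cdot>\<^sub>v w"
      using u w A by (simp add: v_def mult_add_distrib_mat_vec[of A d d] mult_mat_vec[of A d d]
          smult_smult_assoc)
    \<comment> \<open>Inner products are written as forms of the identity matrix so that the same
      bilinear rules expand them.\<close>
    have "v \<bullet>c v = sform (1\<^sub>m d) v v" using v by (simp add: sform_one)
    also have "\<dots> = N + s * cnj s * M"
      using u w by (simp add: v_def sform_linear[of "1\<^sub>m d" d],
          simp add: sform_one orth N_def M_def)
    finally have vv: "v \<bullet>c v = N + s * cnj s * M" .
    have "sform A v v = sform (1\<^sub>m d) (A *\<^sub>v v) v"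
      using A v by (simp add: sform_def)
    also have "\<dots> = a * N + b * (s * cnj s) * M"
      unfolding Av using u w
      by (simp add: v_def sform_linear[of "1\<^sub>m d" d],
          simp add: sform_one orth N_def M_def)
    finally have Avv: "sform A v v = a * N + b * (s * cnj s) * M" .
    have 1: "sform T v (A *\<^sub>v v) = a * sform T u u + b * cnj s * sform T u w
        + a * s * sform T w u + b * (s * cnj s) * sform T w w"
      unfolding Av using u w T by (simp add: v_def sform_linear[of T d] re algebra_simps)
    have 2: "sform T (A *\<^sub>v v) v = a * sform T u u + a * cnj s * sform T u w
        + b * s * sform T w u + b * (s * cnj s) * sform T w w"
      unfolding Av using u w T by (simp add: v_def sform_linear[of T d] algebra_simps)
    have 3: "sform T v v = sform T u u + cnj s * sform T u w + s * sform T w u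
        + s * cnj s * sform T w w"
      using u w T by (simp add: v_def sform_linear[of T d] algebra_simps)
    have "(a - b) * (2 * (s * cnj s) * D + (s * cnj s * M - N) * K s)
        = (v \<bullet>c v) * (sform T v (A *\<^sub>v v) + sform T (A *\<^sub>v v) v) - 2 * sform A v v * sform T v v"
      unfolding vv Avv 1 2 3 D_def K_def by (simp add: algebra_simps)
    thus ?thesis using ab H[OF v] by simp
  qed
  \<comment> \<open>Passing from \<open>s\<close> to \<open>- s\<close> fixes
    \<open>s * cnj s\<close> and reverses \<open>K s\<close>, so adding the identities for 1 and -1
    leaves only \<open>D\<close>.\<close>
  have K_minus: "K (- s) = - K s" for s by (simp add: K_def)
  have D0: "D = 0" and K0: "s * cnj s * M = N \<or> K s = 0" for s
    using key[of 1] key[of "-1"] key[of s] K_minus[of 1] by auto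
  show "(w \<bullet>c w) * sform T u u = (u \<bullet>c u) * sform T w w"
    using D0 by (simp add: D_def N_def M_def)
  \<comment> \<open>A real parameter off the one radius at which the factor of \<open>K\<close>
    vanishes: 1 works unless \<open>M = N\<close>, and then 2 does because 4 N differs from
    N.\<close>
  obtain t :: complex where t: "t \<noteq> 0" "cnj t = t" "t * t * M \<noteq> N"
  proof (cases "M = N")
    case True
    thus ?thesis using that[of 2] N0 by simp
  next
    case False
    thus ?thesis using that[of 1] by simp
  qed
  have "K t = 0" "K (\<i> * t) = 0" using K0[of t] K0[of "\<i> * t"] t by (auto simp: algebra_simps)
  hence "t * (sform T u w + sform T w u) = 0" "\<i> * t * (- sform T u w + sform T w u) = 0"
    using t(2) by (simp_all add: K_def algebra_simps)
  hence "sform T u w + sform T w u = 0" "- sform T u w + sform T w u = 0"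
    using t(1) by simp_all
  thus "sform T u w = 0" by (simp add: complex_eq_iff)
qed

text \<open>The candidate scalar \<open>k\<close> is the normalised expectation of \<open>T\<close>
  in one eigenvector. It then suffices that \<open>T - k\<close> pairs any two eigenvectors to zero,
  within one eigenspace as well as between different ones.\<close>

lemma scalar_if_product_form:
  assumes A: "A \<in> carrier_mat d d" "hermitian A" and T: "T \<in> carrier_mat d d"
    and H: "\<And>v. v \<in> carrier_vec d \<Longrightarrow>
      (v \<bullet>c v) * (sform T v (A *\<^sub>v v) + sform T (A *\<^sub>v v) v) = 2 * sform A v v * sform T v v"
    and nonscalar: "\<And>c. A \<noteq> c \<cdot>\<^sub>m 1\<^sub>m d"
  shows "\<exists>c. T = c \<cdot>\<^sub>m 1\<^sub>m d"
proof -
  have sub: "B = c \<cdot>\<^sub>m 1\<^sub>m d"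
    if "B \<in> carrier_mat d d" "B + (- c) \<cdot>\<^sub>m 1\<^sub>m d = 0\<^sub>m d d"
    for B :: "complex mat" and c
  proof (rule eq_matI)
    fix i j assume "i < dim_row (c \<cdot>\<^sub>m 1\<^sub>m d)" "j < dim_col (c \<cdot>\<^sub>m 1\<^sub>m d)"
    hence ij: "i < d" "j < d" by auto
    have "(B + (- c) \<cdot>\<^sub>m 1\<^sub>m d) $$ (i, j) = 0" unfolding that(2) using ij by simp
    thus "B $$ (i, j) = (c \<cdot>\<^sub>m 1\<^sub>m d) $$ (i, j)" using ij that(1) by (auto split: if_splits)
  qed (use that in auto)
  have shift: "(B + (- c) \<cdot>\<^sub>m 1\<^sub>m d) *\<^sub>v v = B *\<^sub>v v + (- c) \<cdot>\<^sub>v v"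
    if "B \<in> carrier_mat d d" "v \<in> carrier_vec d" for B :: "complex mat" and c v
    using that by (auto simp: add_mult_distrib_mat_vec[of B d d] intro!: eq_vecI)
  have shift_carrier: "B + (- c) \<cdot>\<^sub>m 1\<^sub>m d \<in> carrier_mat d d" if "B \<in> carrier_mat d d"
    for B :: "complex mat" and c
    using that by simp
  define ev where "ev v a \<longleftrightarrow> v \<in> carrier_vec d \<and> v \<noteq> 0\<^sub>v d \<and> A *\<^sub>v v = a \<cdot>\<^sub>v v" for v a
  obtain u a w b where uw: "ev u a" "ev w b" "a \<noteq> b"
  proof (rule ccontr)
    assume "\<not> thesis"
    hence same: "\<And>u a w b. ev u a \<Longrightarrow> ev w b \<Longrightarrow> a = b" using that by blast
    \<comment> \<open>The common eigenvalue if an eigenvector exists. Otherwise the value is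
      arbitrary, and only the zero vector remains to be checked.\<close>
    define c where "c = (SOME c. \<exists>v. ev v c)"
    have "A + (- c) \<cdot>\<^sub>m 1\<^sub>m d = 0\<^sub>m d d"
    proof (rule zero_on_eigenvectors_zero[OF A shift_carrier[OF A(1)]])
      fix v a assume v: "v \<in> carrier_vec d" "A *\<^sub>v v = a \<cdot>\<^sub>v v"
      have "A *\<^sub>v v = c \<cdot>\<^sub>v v"
      proof (cases "v = 0\<^sub>v d")
        case True
        thus ?thesis using A by (auto simp: scalar_prod_def)
      next
        case False
        hence "ev v a" using v by (simp add: ev_def)
        moreover from this have "\<exists>v. ev v c" unfolding c_def by (intro someI) auto
        ultimately show ?thesis using same v by blast
      qed
      thus "(A + (- c) \<cdot>\<^sub>m 1\<^sub>m d) *\<^sub>v v = 0\<^sub>v d"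
        unfolding shift[OF A(1) v(1)] using v by auto
    qed
    thus False using sub[OF A(1)] nonscalar by blast
  qed
  define k where "k = sform T u u / (u \<bullet>c u)"
  have u0: "u \<bullet>c u \<noteq> 0" and w0: "w \<bullet>c w \<noteq> 0" using uw by (auto simp: ev_def)
  have pair: "sform T x y = 0" "(y \<bullet>c y) * sform T x x = (x \<bullet>c x) * sform T y y"
    if "ev x s" "ev y t" "s \<noteq> t" for x y s t
    using eigenvectors_of_product_form[OF A T H, of x s y t] that by (auto simp: ev_def)
  have kw: "sform T w w = k * (w \<bullet>c w)"
    using pair(2)[OF uw] u0 by (simp add: k_def field_simps)
  define M where "M = T + (- k) \<cdot>\<^sub>m 1\<^sub>m d"
  have M: "M \<in> carrier_mat d d" using T by (simp add: M_def)
  have sM: "sform M x y = sform T x y - k * (x \<bullet>c y)"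
    if "x \<in> carrier_vec d" "y \<in> carrier_vec d" for x y
    unfolding M_def sform_def shift[OF T that(1)]
    using that T by (simp add: add_scalar_prod_distrib[of _ d])
  have M_diag: "sform M v v = 0" if v: "v \<in> carrier_vec d" "A *\<^sub>v v = c \<cdot>\<^sub>v v" for v c
  proof (cases "v = 0\<^sub>v d")
    case True
    thus ?thesis using M by (simp add: sform_def)
  next
    case False
    hence evc: "ev v c" using v by (simp add: ev_def)
    have "sform T v v = k * (v \<bullet>c v)"
    \<comment> \<open>Comparison needs different eigenvalues: vectors for the eigenvalue
      \<open>a\<close> of \<open>u\<close> are compared with \<open>w\<close>, all others with
      \<open>u\<close> itself.\<close>
    proof (cases "c = a")
      case True
      thus ?thesis using pair(2)[OF uw(2) evc] uw(3) kw w0 by (simp add: field_simps)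
    next
      case False
      thus ?thesis using pair(2)[OF uw(1) evc] u0 by (simp add: k_def field_simps)
    qed
    thus ?thesis using sM v by simp
  qed
  have M_ev: "sform M x y = 0"
    if x: "x \<in> carrier_vec d" "A *\<^sub>v x = s \<cdot>\<^sub>v x" and y: "y \<in> carrier_vec d" "A *\<^sub>v y = t \<cdot>\<^sub>v y"
    for x y s t
  proof (cases "x = 0\<^sub>v d \<or> y = 0\<^sub>v d")
    case True
    thus ?thesis using M x y by (auto simp: sform_def scalar_prod_def)
  next
    case nz: False
    show ?thesis
    proof (cases "s = t")
      case False
      thus ?thesis
        using pair(1)[of x s y t] hermitian_eigenvectors_orthogonal[OF A x(1) y(1) x(2) y(2) False]
          sM[OF x(1) y(1)] nz x y by (simp add: ev_def)
    next
      case st: True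
      \<comment> \<open>Since \<open>x + c y\<close> stays in the eigenspace, \<open>M_diag\<close>
        applies to it; the values 1 and \<open>\<i>\<close> of \<open>c\<close> then separate the
        two off-diagonal terms.\<close>
      have lin: "A *\<^sub>v (x + c \<cdot>\<^sub>v y) = t \<cdot>\<^sub>v (x + c \<cdot>\<^sub>v y)" for c
        using x y A st
        by (simp add: mult_add_distrib_mat_vec[of A d d] mult_mat_vec[of A d d]
            smult_add_distrib_vec[of _ d] smult_smult_assoc mult.commute)
      have "cnj c * sform M x y + c * sform M y x = 0" for c
        using M_diag[OF _ lin, of c] M_diag[OF x] M_diag[OF y] x y M
        by (simp add: sform_linear[of M d] add.commute)
      from this[of 1] this[of \<i>] have "sform M x y + sform M y x = 0" "- sform M x y + sform M y x = 0"
        by (simp_all add: complex_eq_iff)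
      thus ?thesis by (simp add: complex_eq_iff)
    qed
  qed
  have "M = 0\<^sub>m d d"
  proof (rule zero_on_eigenvectors_zero[OF A M])
    fix v a assume v: "v \<in> carrier_vec d" "A *\<^sub>v v = a \<cdot>\<^sub>v v"
    \<comment> \<open>By \<open>M_ev\<close> this vector is orthogonal to every eigenvector, so
      completeness is applied first to it and then to the rows of \<open>M\<close>.\<close>
    show "M *\<^sub>v v = 0\<^sub>v d"
      using M_ev[OF v] M v
      by (intro orthogonal_to_eigenvectors_zero[OF A]) (auto simp: sform_def)
  qed
  thus ?thesis using sub[OF T] by (auto simp: M_def)
qed

subsection \<open>Rank-one operators and linear functionals\<close>

text \<open>The operator \<open>|x><y|\<close>. Two different vectors are allowed because
  multiplying \<open>|v><v|\<close> by rho on one side changes only one of them.\<close>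

definition outer :: "complex vec \<Rightarrow> complex vec \<Rightarrow> complex mat" where
  "outer x y = mat (dim_vec x) (dim_vec y) (\<lambda>(i, j). x $ i * cnj (y $ j))"

lemma ketbra_outer: "ketbra v = outer v v"
  by (simp add: ketbra_def outer_def)

lemma outer_carrier:
  "x \<in> carrier_vec m \<Longrightarrow> y \<in> carrier_vec n \<Longrightarrow> outer x y \<in> carrier_mat m n"
  by (auto simp: outer_def)

lemma mult_outer:
  assumes "A \<in> carrier_mat d d" "x \<in> carrier_vec d" "y \<in> carrier_vec d"
  shows "A * outer x y = outer (A *\<^sub>v x) y"
  using assms
  by (intro eq_matI) (auto simp: outer_def scalar_prod_def sum_distrib_right mult.assoc)

lemma outer_mult_hermitian:
  assumes "A \<in> carrier_mat d d" "hermitian A" "x \<in> carrier_vec d" "y \<in> carrier_vec d"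
  shows "outer x y * A = outer x (A *\<^sub>v y)"
proof (rule eq_matI)
  fix i j assume "i < dim_row (outer x (A *\<^sub>v y))" "j < dim_col (outer x (A *\<^sub>v y))"
  hence ij: "i < d" "j < d" using assms by (auto simp: outer_def)
  have herm: "cnj (A $$ (j, k)) = A $$ (k, j)" if "k < d" for k
    using assms(2) hermitian_iff_index[OF assms(1)] ij that by blast
  show "(outer x y * A) $$ (i, j) = outer x (A *\<^sub>v y) $$ (i, j)"
    using ij assms herm
    by (auto simp: outer_def scalar_prod_def sum_distrib_left mult.assoc mult.commute
        intro!: sum.cong)
qed (use assms in \<open>auto simp: outer_def\<close>)

lemma outer_mult_outer:
  assumes "x \<in> carrier_vec d" "y \<in> carrier_vec d" "z \<in> carrier_vec d" "w \<in> carrier_vec d"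
  shows "outer x y * outer z w = (z \<bullet>c y) \<cdot>\<^sub>m outer x w"
  using assms
  by (intro eq_matI)
    (auto simp: outer_def scalar_prod_def sum_distrib_left sum_distrib_right algebra_simps
      intro!: sum.cong)

lemma mat_trace_mult:
  assumes "A \<in> carrier_mat d d" "B \<in> carrier_mat d d"
  shows "mat_trace (A * B) = (\<Sum>i<d. \<Sum>j<d. A $$ (i, j) * B $$ (j, i))"
  using assms by (auto simp: mat_trace_def scalar_prod_def lessThan_atLeast0 intro!: sum.cong)

lemma linear_functional_repr:
  fixes f :: "complex mat \<Rightarrow> complex"
  assumes add: "\<And>X Y. X \<in> carrier_mat d d \<Longrightarrow> Y \<in> carrier_mat d d \<Longrightarrow> f (X + Y) = f X + f Y"
    and smult: "\<And>c X. X \<in> carrier_mat d d \<Longrightarrow> f (c \<cdot>\<^sub>m X) = c * f X"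
  shows "\<exists>T \<in> carrier_mat d d. \<forall>X \<in> carrier_mat d d. f X = mat_trace (T * X)"
proof -
  define e where "e p = mat d d (\<lambda>q. if q = p then 1 else (0 :: complex))" for p
  \<comment> \<open>The values on the matrix units, with indices exchanged because the trace of
    \<open>T * X\<close> pairs \<open>T $$ (i, j)\<close> with \<open>X $$ (j, i)\<close>.\<close>
  define T where "T = mat d d (\<lambda>(i, j). f (e (j, i)))"
  have T: "T \<in> carrier_mat d d" by (simp add: T_def)
  have "f X = mat_trace (T * X)" if X: "X \<in> carrier_mat d d" for X
  proof -
    \<comment> \<open>The truncation of \<open>X\<close> to the index set \<open>S\<close>, which
      allows an induction that adds one entry at a time.\<close>
    define R where "R S = mat d d (\<lambda>q. if q \<in> S then X $$ q else 0)" for S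
    have e: "e p \<in> carrier_mat d d" and R: "R S \<in> carrier_mat d d" for p S
      by (simp_all add: e_def R_def)
    have "f (R S) = (\<Sum>p\<in>S. f (e p) * X $$ p)" if "finite S" for S
      using that
    proof induction
      case empty
      have "R {} = 0 \<cdot>\<^sub>m R {}" by (rule eq_matI) (auto simp: R_def)
      hence "f (R {}) = 0" using smult[OF R[of "{}"], of 0] by simp
      thus ?case by simp
    next
      case (insert p S)
      have "R (insert p S) = X $$ p \<cdot>\<^sub>m e p + R S"
        using insert.hyps by (intro eq_matI) (auto simp: R_def e_def)
      thus ?case using insert add[of "X $$ p \<cdot>\<^sub>m e p" "R S"] smult e R by (simp add: mult.commute)
    qed
    moreover have "R ({..<d} \<times> {..<d}) = X" using X by (intro eq_matI) (auto simp: R_def)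
    ultimately have "f X = (\<Sum>p\<in>{..<d} \<times> {..<d}. f (e p) * X $$ p)"
      by (metis finite_cartesian_product finite_lessThan)
    also have "\<dots> = (\<Sum>j<d. \<Sum>i<d. f (e (j, i)) * X $$ (j, i))"
      by (simp add: sum.cartesian_product)
    also have "\<dots> = (\<Sum>i<d. \<Sum>j<d. f (e (j, i)) * X $$ (j, i))" by (rule sum.swap)
    finally show ?thesis unfolding mat_trace_mult[OF T X] by (simp add: T_def)
  qed
  thus ?thesis using T by blast
qed

subsection \<open>Traces and commutators\<close>

lemma mat_trace_add:
  assumes "A \<in> carrier_mat d d" "B \<in> carrier_mat d d"
  shows "mat_trace (A + B) = mat_trace A + mat_trace B"
  using assms by (simp add: mat_trace_def sum.distrib)

lemma mat_trace_minus:
  assumes "A \<in> carrier_mat d d" "B \<in> carrier_mat d d"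
  shows "mat_trace (A - B) = mat_trace A - mat_trace B"
  using assms by (simp add: mat_trace_def sum_subtractf)

lemma mat_trace_comm:
  assumes "A \<in> carrier_mat d d" "B \<in> carrier_mat d d"
  shows "mat_trace (A * B) = mat_trace (B * A)"
  unfolding mat_trace_mult[OF assms] mat_trace_mult[OF assms(2,1)]
  by (subst sum.swap) (simp add: mult.commute)

lemma mat_trace_commutator:
  assumes "A \<in> carrier_mat d d" "B \<in> carrier_mat d d"
  shows "mat_trace (commutator A B) = 0"
  unfolding commutator_def using assms
  by (simp add: mat_trace_minus[of _ d] mat_trace_comm[of A d B])

lemma mat_trace_mult_outer:
  assumes "A \<in> carrier_mat d d" "x \<in> carrier_vec d" "y \<in> carrier_vec d"
  shows "mat_trace (A * outer x y) = sform A x y"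
  unfolding mat_trace_mult[OF assms(1) outer_carrier[OF assms(2,3)]] sform_sum[OF assms]
  using assms by (auto simp: outer_def mult.assoc intro!: sum.cong)

lemma commutator_carrier:
  "A \<in> carrier_mat d d \<Longrightarrow> B \<in> carrier_mat d d \<Longrightarrow> commutator A B \<in> carrier_mat d d"
  by (simp add: commutator_def minus_carrier_mat)

lemma Delta_carrier:
  "A \<in> carrier_mat d d \<Longrightarrow> B \<in> carrier_mat d d \<Longrightarrow> Delta A B \<in> carrier_mat d d"
  by (simp add: Delta_def commutator_carrier)

section \<open>Projections, binary measurements, and the double commutator\<close>

lemma ketbra_projection:
  assumes "unit_vector d v"
  shows "ketbra v \<in> carrier_mat d d" "ketbra v * ketbra v = ketbra v" "hermitian (ketbra v)"
proof -
  have v: "v \<in> carrier_vec d" "v \<bullet>c v = 1" using assms by (auto simp: unit_vector_def)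
  show c: "ketbra v \<in> carrier_mat d d" using v by (simp add: ketbra_outer outer_carrier)
  show "ketbra v * ketbra v = ketbra v"
    using outer_mult_outer[OF v(1) v(1) v(1) v(1)] v(2) by (auto simp: ketbra_outer)
  show "hermitian (ketbra v)"
    unfolding hermitian_iff_index[OF c] using v by (auto simp: ketbra_def)
qed

lemma hermitian_one_minus:
  assumes "P \<in> carrier_mat d d" "hermitian P"
  shows "hermitian (1\<^sub>m d - P)"
proof -
  have c: "1\<^sub>m d - P \<in> carrier_mat d d" using assms by (simp add: minus_carrier_mat)
  show ?thesis
    unfolding hermitian_iff_index[OF c]
    using assms(1) assms(2)[unfolded hermitian_iff_index[OF assms(1)]] by auto
qed

lemma projective_measurement_complement:
  assumes P: "P \<in> carrier_mat d d" "P * P = P" "hermitian P"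
  shows "projective_measurement d [P, 1\<^sub>m d - P]"
proof -
  have Q: "1\<^sub>m d - P \<in> carrier_mat d d" using P by (simp add: minus_carrier_mat)
  have 1: "P * (1\<^sub>m d - P) = 0\<^sub>m d d"
    using mult_minus_distrib_mat[OF P(1) one_carrier_mat P(1)] P by simp
  have 2: "(1\<^sub>m d - P) * P = 0\<^sub>m d d"
    using minus_mult_distrib_mat[OF one_carrier_mat P(1) P(1)] P by simp
  have 3: "(1\<^sub>m d - P) * (1\<^sub>m d - P) = 1\<^sub>m d - P"
    using mult_minus_distrib_mat[OF Q one_carrier_mat P(1)] P(1) Q 2 right_mult_one_mat[OF Q] by (auto intro!: eq_matI)
  have 4: "P + (1\<^sub>m d - P + 0\<^sub>m d d) = 1\<^sub>m d"
    using P by (auto intro!: eq_matI)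
  show ?thesis
    using P Q 1 2 3 4 hermitian_one_minus[OF P(1,3)]
    by (auto simp: projective_measurement_def less_Suc_eq numeral_2_eq_2)
qed

text \<open>The first form turns into rank-one operators when \<open>P\<close> has rank one, which
  suits the evaluation of functionals; the second compares \<open>R\<close> with its dephased
  version.\<close>

lemma Delta_projection:
  assumes P: "P \<in> carrier_mat d d" "P * P = P" and R: "R \<in> carrier_mat d d"
  shows "Delta P R = P * R - P * R * P - (P * R * P - R * P)"
    and "Delta P R = R - (P * R * P + (1\<^sub>m d - P) * R * (1\<^sub>m d - P))"
proof -
  have PPR: "P * (P * R) = P * R" using P R by (metis assoc_mult_mat)
  have RPP: "R * P * P = R * P" using P R by (metis assoc_mult_mat)
  have PRP: "P * (R * P) = P * R * P" using P R by (metis assoc_mult_mat)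
  have c: "P * R \<in> carrier_mat d d" "R * P \<in> carrier_mat d d" "P * R * P \<in> carrier_mat d d"
    "1\<^sub>m d - P \<in> carrier_mat d d" "(1\<^sub>m d - P) * R \<in> carrier_mat d d"
    using P R by (auto simp: minus_carrier_mat)
  have "P * (P * R - R * P) = P * R - P * R * P"
    unfolding mult_minus_distrib_mat[OF P(1) c(1,2)] PPR PRP ..
  moreover have "(P * R - R * P) * P = P * R * P - R * P"
    unfolding minus_mult_distrib_mat[OF c(1,2) P(1)] RPP ..
  ultimately show 1: "Delta P R = P * R - P * R * P - (P * R * P - R * P)"
    unfolding Delta_def commutator_def by simp
  have "(1\<^sub>m d - P) * R = R - P * R"
    using minus_mult_distrib_mat[OF one_carrier_mat P(1) R] R by simp
  moreover have "(R - P * R) * (1\<^sub>m d - P) = R - P * R - (R - P * R) * P"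
    using mult_minus_distrib_mat[OF minus_carrier_mat[OF c(1)] one_carrier_mat P(1), of R]
      right_mult_one_mat[OF minus_carrier_mat[OF c(1)]] by metis
  moreover have "(R - P * R) * P = R * P - P * R * P"
    by (rule minus_mult_distrib_mat[OF R c(1) P(1)])
  ultimately have "(1\<^sub>m d - P) * R * (1\<^sub>m d - P) = R - P * R - (R * P - P * R * P)"
    by metis
  thus "Delta P R = R - (P * R * P + (1\<^sub>m d - P) * R * (1\<^sub>m d - P))"
    unfolding 1 using R c by (auto intro!: eq_matI simp del: index_mult_mat assoc_mult_mat)
qed

lemma psd_compress:
  assumes "psd d A" "M \<in> carrier_mat d d" "hermitian M"
  shows "psd d (M * A * M)"
proof -
  have A: "A \<in> carrier_mat d d" using assms by (simp add: psd_def)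
  have "0 \<le> (M * A * M *\<^sub>v v) \<bullet>c v" if v: "v \<in> carrier_vec d" for v
  proof -
    have "M * A * M *\<^sub>v v = M *\<^sub>v (A *\<^sub>v (M *\<^sub>v v))"
      using assms(2) A v by (simp add: assoc_mult_mat_vec[of _ d d _ d])
    hence "(M * A * M *\<^sub>v v) \<bullet>c v = (A *\<^sub>v (M *\<^sub>v v)) \<bullet>c (M *\<^sub>v v)"
      using hermitian_sform[OF assms(2,3), of "A *\<^sub>v (M *\<^sub>v v)" v] assms(2) A v by simp
    thus ?thesis using assms v by (simp add: psd_def)
  qed
  thus ?thesis using A assms(2) by (simp add: psd_def)
qed

subsection \<open>Channels\<close>

lemma linear_map_minus:
  assumes E: "linear_map dA dB \<E>" and X: "X \<in> carrier_mat dA dA" and Y: "Y \<in> carrier_mat dA dA"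
  shows "\<E> (X - Y) = \<E> X - \<E> Y"
proof -
  have c: "\<E> X \<in> carrier_mat dB dB" "\<E> Y \<in> carrier_mat dB dB"
    using E X Y by (auto simp: linear_map_def)
  have "X - Y = X + (- 1) \<cdot>\<^sub>m Y" using X Y by (auto intro!: eq_matI)
  moreover have "\<E> (X + (- 1) \<cdot>\<^sub>m Y) = \<E> X + \<E> ((- 1) \<cdot>\<^sub>m Y)"
    using E X Y smult_carrier_mat[OF Y] unfolding linear_map_def by blast
  moreover have "\<E> ((- 1) \<cdot>\<^sub>m Y) = (- 1) \<cdot>\<^sub>m \<E> Y" using E Y unfolding linear_map_def by blast
  ultimately have "\<E> (X - Y) = \<E> X + (- 1) \<cdot>\<^sub>m \<E> Y" by simp
  also have "\<dots> = \<E> X - \<E> Y" using c by (auto intro!: eq_matI)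
  finally show ?thesis .
qed

text \<open>For \<open>k = 1\<close> the only block is the whole matrix, so the ampliation is the
  map itself.\<close>

lemma completely_positive_psd:
  assumes cp: "completely_positive dA dB \<E>" and E: "linear_map dA dB \<E>" and X: "psd dA X"
  shows "psd dB (\<E> X)"
proof -
  have Xc: "X \<in> carrier_mat dA dA" using X by (simp add: psd_def)
  have EX: "\<E> X \<in> carrier_mat dB dB" using E Xc by (auto simp: linear_map_def)
  have "block dA X 0 0 = X" using Xc by (auto simp: block_def intro!: eq_matI)
  hence "ampliation 1 dA dB \<E> X = \<E> X" using EX by (auto simp: ampliation_def intro!: eq_matI)
  moreover have "psd (1 * dB) (ampliation 1 dA dB \<E> X)"
    using cp X unfolding completely_positive_def by (metis mult_1)
  ultimately show ?thesis by simp
qed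

lemma channel_Delta_hermitian:
  assumes "quantum_channel dA dB \<E>" "psd dA R" "unit_vector dA v"
  shows "hermitian (\<E> (Delta (ketbra v) R))"
proof -
  note P = ketbra_projection[OF assms(3)]
  let ?P = "ketbra v" and ?P' = "1\<^sub>m dA - ketbra v"
  have E: "linear_map dA dB \<E>" "completely_positive dA dB \<E>"
    using assms(1) by (auto simp: quantum_channel_def)
  have P': "?P' \<in> carrier_mat dA dA" "hermitian ?P'"
    using P hermitian_one_minus[OF P(1,3)] by (auto simp: minus_carrier_mat)
  have psd: "psd dA (?P * R * ?P)" "psd dA (?P' * R * ?P')"
    using psd_compress assms(2) P P' by blast+
  have c: "R \<in> carrier_mat dA dA" "?P * R * ?P \<in> carrier_mat dA dA" "?P' * R * ?P' \<in> carrier_mat dA dA"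
    using psd assms(2) by (auto simp: psd_def)
  have Epsd: "psd dB (\<E> X)" if "psd dA X" for X
    using completely_positive_psd[OF E(2,1) that] .
  have Ec: "\<E> X \<in> carrier_mat dB dB" if "X \<in> carrier_mat dA dA" for X
    using E(1) that by (auto simp: linear_map_def)
  let ?Y = "\<E> R - (\<E> (?P * R * ?P) + \<E> (?P' * R * ?P'))"
  have "\<E> (Delta ?P R) = \<E> R - \<E> (?P * R * ?P + ?P' * R * ?P')"
    unfolding Delta_projection(2)[OF P(1,2) c(1)] using c
    by (intro linear_map_minus[OF E(1)]) auto
  also have "\<E> (?P * R * ?P + ?P' * R * ?P') = \<E> (?P * R * ?P) + \<E> (?P' * R * ?P')"
    using E(1) c unfolding linear_map_def by blast
  finally have Y: "\<E> (Delta ?P R) = ?Y" .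
  have Yc: "?Y \<in> carrier_mat dB dB" using Ec c by (simp add: minus_carrier_mat)
  have h: "\<forall>i<dB. \<forall>j<dB. cnj (\<E> X $$ (j, i)) = \<E> X $$ (i, j)" if "psd dA X" for X
    using psd_hermitian[OF Epsd[OF that]] hermitian_iff_index[OF Ec] that by (auto simp: psd_def)
  show ?thesis
    unfolding Y hermitian_iff_index[OF Yc]
    using Ec[OF c(1)] Ec[OF c(2)] Ec[OF c(3)] h[OF assms(2)] h[OF psd(1)] h[OF psd(2)] by simp
qed

lemma unit_vector_scaling:
  assumes "v \<in> carrier_vec d" "v \<noteq> 0\<^sub>v d"
  shows "\<exists>c. unit_vector d (c \<cdot>\<^sub>v v) \<and> c \<noteq> 0"
proof -
  define r where "r = Re (v \<bullet>c v)"
  have "v \<bullet>c v > 0" using assms by simp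
  hence r: "v \<bullet>c v = complex_of_real r" "r > 0"
    by (auto simp: r_def less_complex_def complex_eq_iff)
  define c where "c = complex_of_real (1 / sqrt r)"
  have "c * cnj c = complex_of_real (1 / r)"
    using r(2) by (simp add: c_def flip: of_real_mult)
  moreover have "cnj c * (c * (v \<bullet>c v)) = c * cnj c * (v \<bullet>c v)" by (simp add: ac_simps)
  ultimately have "cnj c * (c * (v \<bullet>c v)) = 1" using r by simp
  hence "unit_vector d (c \<cdot>\<^sub>v v)"
    using assms by (simp add: unit_vector_def conjugate_smult_vec)
  moreover have "c \<noteq> 0" using r(2) by (simp add: c_def)
  ultimately show ?thesis by blast
qed

text \<open>If a Hermitian matrix annihilated all its eigenvectors, it would be zero by
  \<open>zero_on_eigenvectors_zero\<close> applied with \<open>M = A\<close>.\<close>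

lemma hermitian_nonzero_eigenvector:
  assumes A: "A \<in> carrier_mat d d" "hermitian A" and "A \<noteq> 0\<^sub>m d d"
  shows "\<exists>(r :: real) y. r \<noteq> 0 \<and> unit_vector d y \<and> eigenvector A y (complex_of_real r)"
proof -
  obtain v a where v: "v \<in> carrier_vec d" "A *\<^sub>v v = a \<cdot>\<^sub>v v" "A *\<^sub>v v \<noteq> 0\<^sub>v d"
    using zero_on_eigenvectors_zero[OF A A(1)] assms(3) by blast
  have v0: "v \<noteq> 0\<^sub>v d" using v A by (auto simp: scalar_prod_def)
  have a: "a \<noteq> 0" "cnj a = a"
    using v hermitian_eigenvalue_real[OF A v(1) v0 v(2)] by auto
  obtain c where c: "unit_vector d (c \<cdot>\<^sub>v v)" "c \<noteq> 0"
    using unit_vector_scaling[OF v(1) v0] by blast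
  have "A *\<^sub>v (c \<cdot>\<^sub>v v) = a \<cdot>\<^sub>v (c \<cdot>\<^sub>v v)"
    using v A by (simp add: mult_mat_vec[of A d d] smult_smult_assoc mult.commute)
  moreover have "c \<cdot>\<^sub>v v \<noteq> 0\<^sub>v d" using c by (auto simp: unit_vector_def)
  ultimately have "eigenvector A (c \<cdot>\<^sub>v v) a"
    using A v by (simp add: eigenvector_def)
  moreover have "a = complex_of_real (Re a)" "Re a \<noteq> 0"
    using a by (auto simp: complex_eq_iff)
  ultimately show ?thesis using c by metis
qed

lemma channel_trivial_if_dephasing_invisible:
  assumes E: "quantum_channel dA dB \<E>" and rho: "psd dA R"
    and nonscalar: "\<And>c. R \<noteq> c \<cdot>\<^sub>m 1\<^sub>m dA"
    and zero: "\<And>v. unit_vector dA v \<Longrightarrow> \<E> (Delta (ketbra v) R) = 0\<^sub>m dB dB"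
    and X: "X \<in> carrier_mat dA dA" and Y: "Y \<in> carrier_mat dA dA"
    and tr: "mat_trace X = mat_trace Y"
  shows "\<E> X = \<E> Y"
proof -
  have lin: "linear_map dA dB \<E>" using E by (simp add: quantum_channel_def)
  have R: "R \<in> carrier_mat dA dA" "hermitian R" using rho psd_hermitian by (auto simp: psd_def)
  have Ec: "\<E> X \<in> carrier_mat dB dB" if "X \<in> carrier_mat dA dA" for X
    using lin that by (auto simp: linear_map_def)
  have "\<E> X $$ (p, q) = \<E> Y $$ (p, q)" if pq: "p < dB" "q < dB" for p q
  proof -
    define f where "f X = \<E> X $$ (p, q)" for X
    have f_add: "f (X + Y) = f X + f Y" if "X \<in> carrier_mat dA dA" "Y \<in> carrier_mat dA dA" for X Y
    proof -
      have "\<E> (X + Y) = \<E> X + \<E> Y" using lin that unfolding linear_map_def by blast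
      thus ?thesis using Ec[OF that(1)] Ec[OF that(2)] pq by (auto simp: f_def)
    qed
    have f_smult: "f (c \<cdot>\<^sub>m X) = c * f X" if "X \<in> carrier_mat dA dA" for c X
    proof -
      have "\<E> (c \<cdot>\<^sub>m X) = c \<cdot>\<^sub>m \<E> X" using lin that unfolding linear_map_def by blast
      thus ?thesis using Ec[OF that] pq by (auto simp: f_def)
    qed
    obtain T where T: "T \<in> carrier_mat dA dA"
      and fT: "\<And>X. X \<in> carrier_mat dA dA \<Longrightarrow> f X = mat_trace (T * X)"
      using linear_functional_repr[OF f_add f_smult] by blast
    \<comment> \<open>With \<open>P = |v><v|\<close> the operator is
      \<open>P R + R P - 2 P R P\<close>, and \<open>P R P\<close> is the expectation of
      \<open>R\<close> times \<open>P\<close>; pairing with \<open>T\<close> gives the three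
      terms.\<close>
    have unit: "sform T v (R *\<^sub>v v) + sform T (R *\<^sub>v v) v = 2 * sform R v v * sform T v v"
      if u: "unit_vector dA v" for v
    proof -
      have v: "v \<in> carrier_vec dA" "R *\<^sub>v v \<in> carrier_vec dA"
        using u R by (auto simp: unit_vector_def)
      have PR: "outer v v * R = outer v (R *\<^sub>v v)"
        using outer_mult_hermitian[OF R v(1) v(1)] .
      have RP: "R * outer v v = outer (R *\<^sub>v v) v"
        using mult_outer[OF R(1) v(1) v(1)] .
      have "outer v v * R * outer v v = (v \<bullet>c (R *\<^sub>v v)) \<cdot>\<^sub>m outer v v"
        unfolding PR using outer_mult_outer[OF v(1,2) v(1) v(1)] .
      also have "v \<bullet>c (R *\<^sub>v v) = sform R v v"
        using hermitian_sform[OF R v(1) v(1)] by (simp add: sform_def)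
      finally have PRP: "outer v v * R * outer v v = sform R v v \<cdot>\<^sub>m outer v v" .
      have c: "outer v v \<in> carrier_mat dA dA" "outer v (R *\<^sub>v v) \<in> carrier_mat dA dA"
        "outer (R *\<^sub>v v) v \<in> carrier_mat dA dA"
        using v outer_carrier by blast+
      have Delta: "Delta (ketbra v) R = outer v (R *\<^sub>v v) - sform R v v \<cdot>\<^sub>m outer v v
          - (sform R v v \<cdot>\<^sub>m outer v v - outer (R *\<^sub>v v) v)"
        using Delta_projection(1)[OF ketbra_projection(1,2)[OF u] R(1)]
        unfolding ketbra_outer PR RP PRP[unfolded PR] .
      have "f (X - Y) = f X - f Y" if "X \<in> carrier_mat dA dA" "Y \<in> carrier_mat dA dA" for X Y
        unfolding f_def linear_map_minus[OF lin that] using Ec[OF that(1)] Ec[OF that(2)] pq by auto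
      hence "f (Delta (ketbra v) R) = f (outer v (R *\<^sub>v v)) - f (sform R v v \<cdot>\<^sub>m outer v v)
          - (f (sform R v v \<cdot>\<^sub>m outer v v) - f (outer (R *\<^sub>v v) v))"
        unfolding Delta using c by (simp add: minus_carrier_mat)
      also have "f (sform R v v \<cdot>\<^sub>m outer v v) = sform R v v * f (outer v v)"
        using f_smult c by blast
      finally show ?thesis
        using zero[OF u] c v T fT pq
        by (simp add: mat_trace_mult_outer[OF T] f_def)
    qed
    have "\<exists>c. T = c \<cdot>\<^sub>m 1\<^sub>m dA"
    proof (rule scalar_if_product_form[OF R T _ nonscalar])
      fix v :: "complex vec" assume v: "v \<in> carrier_vec dA"
      show "(v \<bullet>c v) * (sform T v (R *\<^sub>v v) + sform T (R *\<^sub>v v) v) = 2 * sform R v v * sform T v v"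
      proof (cases "v = 0\<^sub>v dA")
        case True
        thus ?thesis using T by (simp add: sform_def)
      next
        case False
        obtain c where c: "unit_vector dA (c \<cdot>\<^sub>v v)" "c \<noteq> 0"
          using unit_vector_scaling[OF v False] by blast
        have n: "c * cnj c * (v \<bullet>c v) = 1"
          using c(1) v by (simp add: unit_vector_def conjugate_smult_vec mult.assoc mult.left_commute)
        have Rv: "R *\<^sub>v v \<in> carrier_vec dA" "R *\<^sub>v (c \<cdot>\<^sub>v v) = c \<cdot>\<^sub>v (R *\<^sub>v v)"
          using R v by (auto simp: mult_mat_vec[of R dA dA])
        \<comment> \<open>Rescaling gives one factor \<open>c * cnj c\<close> on the left and two on
          the right. The surplus one is the inverse of \<open>v \<bullet>c v\<close>.\<close>
        have "c * cnj c * (sform T v (R *\<^sub>v v) + sform T (R *\<^sub>v v) v)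
            = c * cnj c * (2 * (c * cnj c) * sform R v v * sform T v v)"
          using unit[OF c(1)] v Rv T R
          by (simp add: sform_smult_left[of _ dA] sform_smult_right[of _ dA] algebra_simps)
        hence "sform T v (R *\<^sub>v v) + sform T (R *\<^sub>v v) v
            = 2 * (c * cnj c) * sform R v v * sform T v v"
          using c(2) by simp
        hence "(v \<bullet>c v) * (sform T v (R *\<^sub>v v) + sform T (R *\<^sub>v v) v)
            = (c * cnj c * (v \<bullet>c v)) * (2 * sform R v v * sform T v v)"
          by (simp add: algebra_simps)
        thus ?thesis unfolding n by simp
      qed
    qed
    then obtain k where "T = k \<cdot>\<^sub>m 1\<^sub>m dA" ..
    hence "f X = k * mat_trace X" if "X \<in> carrier_mat dA dA" for X
      using fT[OF that] that by (simp add: mat_trace_def sum_distrib_left)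
    thus ?thesis using X Y tr by (simp add: f_def)
  qed
  thus ?thesis using Ec[OF X] Ec[OF Y] by (auto intro!: eq_matI)
qed

lemma mat_trace_eigenvector:
  assumes Y: "Y \<in> carrier_mat d d" and y: "eigenvector Y y c" "unit_vector d y"
  shows "mat_trace (Y * ketbra y) = c"
proof -
  have y': "y \<in> carrier_vec d" "y \<bullet>c y = 1" using y(2) by (auto simp: unit_vector_def)
  have "Y *\<^sub>v y = c \<cdot>\<^sub>v y" using y(1) by (simp add: eigenvector_def)
  thus ?thesis
    using y' by (simp add: ketbra_outer mat_trace_mult_outer[OF Y y'(1) y'(1)] sform_def)
qed

section \<open>The disturbance identity and the violation of NSIT\<close>

theorem mainTheorem2:
  fixes dA dB :: nat
    and \<rho> :: "complex mat"
    and \<E> :: "complex mat \<Rightarrow> complex mat"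
  assumes "dA > 1"
    and "state dA \<rho>"
    and "\<rho> \<noteq> (1 / of_nat dA) \<cdot>\<^sub>m 1\<^sub>m dA"
    and "quantum_channel dA dB \<E>"
    and "\<not> discard_and_prepare dA dB \<E>"
  shows
    "(\<exists>v. unit_vector dA v \<and> \<E> (Delta (ketbra v) \<rho>) \<noteq> 0\<^sub>m dB dB) \<and>
     (\<forall>v P Y. unit_vector dA v \<and> P = ketbra v \<and> Y = \<E> (Delta P \<rho>) \<and> Y \<noteq> 0\<^sub>m dB dB \<longrightarrow>
        hermitian Y \<and> mat_trace Y = 0 \<and>
        (\<exists>r :: real. r \<noteq> 0 \<and> eigenvalue Y (complex_of_real r)) \<and>
        (\<forall>y0 y Q. y0 \<noteq> 0 \<and> eigenvector Y y y0 \<and> unit_vector dB y \<and> Q = ketbra y \<longrightarrow>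
           mat_trace (\<E> \<rho> * Q)
             - mat_trace (\<E> (P * \<rho> * P + (1\<^sub>m dA - P) * \<rho> * (1\<^sub>m dA - P)) * Q)
             = mat_trace (Y * Q) \<and>
           mat_trace (Y * Q) = y0 \<and> y0 \<noteq> 0)) \<and>
     (\<exists>P Q. projective_measurement dA [P, 1\<^sub>m dA - P] \<and>
        projective_measurement dB [Q, 1\<^sub>m dB - Q] \<and>
        \<not> NSIT \<rho> \<E> [P, 1\<^sub>m dA - P] [Q, 1\<^sub>m dB - Q])"
proof -
  have E: "linear_map dA dB \<E>" "completely_positive dA dB \<E>"
    and E_trace: "\<And>X. X \<in> carrier_mat dA dA \<Longrightarrow> mat_trace (\<E> X) = mat_trace X"
    using assms(4) by (auto simp: quantum_channel_def)
  have \<rho>: "psd dA \<rho>" "\<rho> \<in> carrier_mat dA dA" "mat_trace \<rho> = 1"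
    using assms(2) by (auto simp: state_def psd_def)
  have Ec: "\<E> X \<in> carrier_mat dB dB" if "X \<in> carrier_mat dA dA" for X
    using E(1) that by (auto simp: linear_map_def)
  \<comment> \<open>Trace one leaves \<open>1 / dA\<close> as the only possible scalar.\<close>
  have nonscalar: "\<rho> \<noteq> c \<cdot>\<^sub>m 1\<^sub>m dA" for c
  proof
    assume *: "\<rho> = c \<cdot>\<^sub>m 1\<^sub>m dA"
    have "of_nat dA * c = 1" using \<rho>(3) unfolding * by (simp add: mat_trace_def)
    hence "c = 1 / of_nat dA" using assms(1) by (simp add: field_simps)
    thus False using * assms(3) by simp
  qed
  obtain v where v: "unit_vector dA v" "\<E> (Delta (ketbra v) \<rho>) \<noteq> 0\<^sub>m dB dB"
  proof (rule ccontr)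
    assume "\<not> thesis"
    hence zero: "\<And>v. unit_vector dA v \<Longrightarrow> \<E> (Delta (ketbra v) \<rho>) = 0\<^sub>m dB dB"
      using that by blast
    \<comment> \<open>All states have trace one, so they share the output
      \<open>\<E> \<rho>\<close>, which is the prepared state.\<close>
    have "\<E> \<omega> = \<E> \<rho>" if "state dA \<omega>" for \<omega>
      using that \<rho>
      by (intro channel_trivial_if_dephasing_invisible[OF assms(4) \<rho>(1) nonscalar zero])
        (auto simp: state_def psd_def)
    moreover have "state dB (\<E> \<rho>)"
      using completely_positive_psd[OF E(2,1) \<rho>(1)] E_trace[OF \<rho>(2)] \<rho>(3) by (simp add: state_def)
    ultimately show False using assms(5) by (auto simp: discard_and_prepare_def)
  qed
  define deph where "deph P = P * \<rho> * P + (1\<^sub>m dA - P) * \<rho> * (1\<^sub>m dA - P)" for P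
  have blocks: "ketbra v * \<rho> * ketbra v \<in> carrier_mat dA dA"
    "(1\<^sub>m dA - ketbra v) * \<rho> * (1\<^sub>m dA - ketbra v) \<in> carrier_mat dA dA"
    if "unit_vector dA v" for v
    using ketbra_projection(1)[OF that] \<rho>(2)
    by (auto intro!: mult_carrier_mat minus_carrier_mat)
  have Delta_c: "Delta (ketbra v) \<rho> \<in> carrier_mat dA dA" if "unit_vector dA v" for v
    using Delta_carrier[OF ketbra_projection(1)[OF that] \<rho>(2)] .
  have disturbance: "mat_trace (\<E> \<rho> * ketbra y) - mat_trace (\<E> (deph (ketbra v)) * ketbra y)
      = mat_trace (\<E> (Delta (ketbra v) \<rho>) * ketbra y)"
    if v: "unit_vector dA v" and y: "unit_vector dB y" for v y
  proof -
    have deph_c: "deph (ketbra v) \<in> carrier_mat dA dA"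
      unfolding deph_def using blocks[OF v] by (intro add_carrier_mat)
    note Q = ketbra_projection(1)[OF y]
    have "\<E> (Delta (ketbra v) \<rho>) = \<E> \<rho> - \<E> (deph (ketbra v))"
      unfolding Delta_projection(2)[OF ketbra_projection(1,2)[OF v] \<rho>(2)] deph_def[symmetric]
      by (rule linear_map_minus[OF E(1) \<rho>(2) deph_c])
    hence "\<E> (Delta (ketbra v) \<rho>) * ketbra y = \<E> \<rho> * ketbra y - \<E> (deph (ketbra v)) * ketbra y"
      using minus_mult_distrib_mat[OF Ec[OF \<rho>(2)] Ec[OF deph_c] Q] by simp
    thus ?thesis
      using mat_trace_minus[OF mult_carrier_mat[OF Ec[OF \<rho>(2)] Q] mult_carrier_mat[OF Ec[OF deph_c] Q]]
      by simp
  qed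
  have herm: "hermitian (\<E> (Delta (ketbra v) \<rho>))" if "unit_vector dA v" for v
    using channel_Delta_hermitian[OF assms(4) \<rho>(1) that] .
  have traceless: "mat_trace (\<E> (Delta (ketbra v) \<rho>)) = 0" if "unit_vector dA v" for v
    using E_trace[OF Delta_c[OF that]] ketbra_projection(1)[OF that] \<rho>(2)
    by (simp add: Delta_def mat_trace_commutator commutator_carrier)
  have part2: "hermitian Y \<and> mat_trace Y = 0 \<and>
        (\<exists>r :: real. r \<noteq> 0 \<and> eigenvalue Y (complex_of_real r)) \<and>
        (\<forall>y0 y Q. y0 \<noteq> 0 \<and> eigenvector Y y y0 \<and> unit_vector dB y \<and> Q = ketbra y \<longrightarrow>
           mat_trace (\<E> \<rho> * Q) - mat_trace (\<E> (deph P) * Q) = mat_trace (Y * Q) \<and>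
           mat_trace (Y * Q) = y0 \<and> y0 \<noteq> 0)"
    if *: "unit_vector dA v" "P = ketbra v" "Y = \<E> (Delta P \<rho>)" "Y \<noteq> 0\<^sub>m dB dB" for v P Y
  proof -
    have Y: "Y \<in> carrier_mat dB dB" using * Ec Delta_c by simp
    have h: "hermitian Y" using * herm by simp
    have "\<exists>r :: real. r \<noteq> 0 \<and> eigenvalue Y (complex_of_real r)"
      using hermitian_nonzero_eigenvector[OF Y h *(4)] by (auto simp: eigenvalue_def)
    moreover have "mat_trace (\<E> \<rho> * ketbra y) - mat_trace (\<E> (deph P) * ketbra y)
        = mat_trace (Y * ketbra y)" if "unit_vector dB y" for y
      using disturbance[OF *(1) that] * by simp
    ultimately show ?thesis using h traceless[OF *(1)] mat_trace_eigenvector[OF Y] * by auto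
  qed
  define Y where "Y = \<E> (Delta (ketbra v) \<rho>)"
  have Y: "Y \<in> carrier_mat dB dB" "hermitian Y" "Y \<noteq> 0\<^sub>m dB dB"
    using Ec[OF Delta_c[OF v(1)]] herm[OF v(1)] v(2) by (auto simp: Y_def)
  obtain r :: real and y where y: "r \<noteq> 0" "unit_vector dB y" "eigenvector Y y (complex_of_real r)"
    using hermitian_nonzero_eigenvector[OF Y] by blast
  let ?P = "ketbra v" and ?Q = "ketbra y"
  \<comment> \<open>NSIT adds the outcomes after the channel, \<open>deph\<close> before it;
    linearity identifies the two.\<close>
  have "\<E> (deph ?P) = \<E> (?P * \<rho> * ?P) + \<E> ((1\<^sub>m dA - ?P) * \<rho> * (1\<^sub>m dA - ?P))"
    using E(1) blocks[OF v(1)] unfolding linear_map_def deph_def by blast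
  hence "mat_trace (\<E> (?P * \<rho> * ?P) * ?Q) + mat_trace (\<E> ((1\<^sub>m dA - ?P) * \<rho> * (1\<^sub>m dA - ?P)) * ?Q)
      = mat_trace (\<E> (deph ?P) * ?Q)"
    using add_mult_distrib_mat[OF Ec[OF blocks(1)[OF v(1)]] Ec[OF blocks(2)[OF v(1)]]
        ketbra_projection(1)[OF y(2)]]
      mat_trace_add[OF mult_carrier_mat[OF Ec[OF blocks(1)[OF v(1)]] ketbra_projection(1)[OF y(2)]]
        mult_carrier_mat[OF Ec[OF blocks(2)[OF v(1)]] ketbra_projection(1)[OF y(2)]]]
    by simp
  \<comment> \<open>The two sides differ by the eigenvalue \<open>r\<close>, so the outcome
    \<open>?Q\<close> already violates the condition.\<close>
  moreover have "mat_trace (\<E> (deph ?P) * ?Q) \<noteq> mat_trace (\<E> \<rho> * ?Q)"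
    using disturbance[OF v(1) y(2)] mat_trace_eigenvector[OF Y(1) y(3,2)] y(1)
    by (auto simp: Y_def)
  ultimately have "\<not> NSIT \<rho> \<E> [?P, 1\<^sub>m dA - ?P] [?Q, 1\<^sub>m dB - ?Q]"
    by (auto simp: NSIT_def)
  moreover have "projective_measurement dA [?P, 1\<^sub>m dA - ?P]"
    "projective_measurement dB [?Q, 1\<^sub>m dB - ?Q]"
    using projective_measurement_complement ketbra_projection v(1) y(2) by blast+
  ultimately show ?thesis using v part2 unfolding deph_def by blast
qed

end
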